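(* The functor $\mathrm{S}:\mathbf{Monogr}\to\mathbf{GrStruct}$ is an isomorphism-dense embedding, i.e. it is faithful, injective on objects, and every graph structure is isomorphic in $\mathbf{GrStruct}$ to $\mathrm{S}(T)$ for some monograph $T$.
   Context: A monograph is a set $T$ of ordered pairs which is a functional relation with domain some set $\mathrm{E}_T$ (the edges) such that each $T(e)$ is a function $\lambda\to\mathrm{E}_T$ for some ordinal $\lambda=|e|$; $e_\iota$ denotes $T(e)(\iota)$. A morphism $f:T\to T'$ is a function $f:\mathrm{E}_T\to\mathrm{E}_{T'}$ with $|f(e)|=|e|$ and $f(e_\iota)=f(e)_\iota$; $\mathbf{Monogr}$ is the resulting category. A signature is a function $\Sigma:\Omega\to S^{<\omega}$ with $\Sigma(o)$ nonempty for all $o$; it is a graph structure if every $\Sigma(o)$ has length $2$ (domain sort followed by range sort). A morphism of signatures $\Sigma\to\Sigma'$ (with $\Sigma':\Omega'\to S'^{<\omega}$) is a pair $\langle r_\Omega,r_S\rangle$ with $r_\Omega:\Omega\to\Omega'$, $r_S:S\to S'$ and $\Sigma'(r_\Omega(o))=r_S\circ\Sigma(o)$ for all $o$; composition is componentwise. $\mathbf{GrStruct}$ is the category of graph structures with these morphisms. For a monograph $T$, $\Omega_T=\{[e,\iota]:e\in\mathrm{E}_T,\iota<|e|\}$ and $\mathrm{S}(T):\Omega_T\to\mathrm{E}_T^{<\omega}$, $\mathrm{S}(T)([e,\iota])=e\,e_\iota$. For a morphism $f:T\to T'$, $\mathrm{S}(f)=\langle [e,\iota]\mapsto[f(e),\iota],\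 f\rangle$. *)

theory Defs
  imports Main "HOL-Library.FuncSet"
begin

text \<open>
  The ordinals that are order types of well-orders on subsets of \<open>'a\<close>.  The class of all ordinals
  is not a type; it is covered by letting \<open>'a\<close> vary.
\<close>

quotient_type 'a ordinal = "'a rel" / partial: "\<lambda>r s. (r, s) \<in> ordIso"
proof (rule part_equivpI)
  have "({} :: 'a rel, {} :: 'a rel) \<in> ordIso"
    by (rule ordIso_reflexive) simp
  then show "\<exists>r :: 'a rel. (r, r) \<in> ordIso" by blast
  show "symp (\<lambda>r s :: 'a rel. (r, s) \<in> ordIso)"
    by (auto intro: sympI ordIso_symmetric)
  show "transp (\<lambda>r s :: 'a rel. (r, s) \<in> ordIso)"
    by (auto intro: transpI ordIso_transitive)
qed

instantiation ordinal :: (type) wellorder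
begin

lift_definition less_eq_ordinal :: "'a ordinal \<Rightarrow> 'a ordinal \<Rightarrow> bool"
  is "\<lambda>r s. (r, s) \<in> ordLeq"
  by (meson ordIso_ordLeq_trans ordIso_symmetric ordLeq_ordIso_trans)

lift_definition less_ordinal :: "'a ordinal \<Rightarrow> 'a ordinal \<Rightarrow> bool"
  is "\<lambda>r s. (r, s) \<in> ordLess"
  by (meson ordIso_ordLess_trans ordIso_symmetric ordLess_ordIso_trans)

instance
proof
  fix x y z :: "'a ordinal"
  show "x < y \<longleftrightarrow> x \<le> y \<and> \<not> y \<le> x"
    by transfer (metis not_ordLess_iff_ordLeq not_ordLess_ordLeq ordIso_imp_ordLeq
        ordLeq_Well_order_simp ordLess_imp_ordLeq)
  show "x \<le> x"
    by transfer (simp add: ordIso_imp_ordLeq)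
  show "x \<le> z" if "x \<le> y" "y \<le> z"
    using that by transfer (rule ordLeq_transitive)
  show "x = y" if "x \<le> y" "y \<le> x"
    using that by transfer (simp add: ordIso_iff_ordLeq)
  show "x \<le> y \<or> y \<le> x"
    by transfer (metis ordIso_imp_ordLeq ordLeq_Well_order_simp ordLeq_total)
  show "P x" if step: "\<And>x. (\<And>y. y < x \<Longrightarrow> P y) \<Longrightarrow> P x" for P and x :: "'a ordinal"
  proof -
    have "P (abs_ordinal r)" if "(r, r) \<in> ordIso" for r :: "'a rel"
      using wf_ordLess that
    proof (induction r rule: wf_induct_rule)
      case (less r)
      show ?case
      proof (rule step)
        fix y assume y: "y < abs_ordinal r"
        obtain s where s: "(s, s) \<in> ordIso" "y = abs_ordinal s"
          by (rule that[of "rep_ordinal y"])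
            (simp_all add: Quotient3_abs_rep[OF Quotient3_ordinal] Quotient3_rep_reflp[OF Quotient3_ordinal])
        have "(s, r) \<in> ordLess"
          using y s less.prems by (simp add: less_ordinal.abs_eq)
        then show "P y" using less.IH s by blast
      qed
    qed
    from this[OF Quotient3_rep_reflp[OF Quotient3_ordinal, of x]] show ?thesis
      by (simp add: Quotient3_abs_rep[OF Quotient3_ordinal])
  qed
qed

end

text \<open>Functional relations are partial maps, so that equality of monographs is equality of sets of pairs.\<close>

type_synonym ('e, 'a) monograph = "'e \<rightharpoonup> ('a ordinal \<rightharpoonup> 'e)"

definition edges :: "('e, 'a) monograph \<Rightarrow> 'e set" where
  "edges T = dom T"

definition is_monograph :: "('e, 'a) monograph \<Rightarrow> bool" where
  "is_monograph T \<longleftrightarrow>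
     (\<forall>e\<in>edges T. (\<exists>l. dom (the (T e)) = {..<l}) \<and> ran (the (T e)) \<subseteq> edges T)"

definition len :: "('e, 'a) monograph \<Rightarrow> 'e \<Rightarrow> 'a ordinal" where
  "len T e = (THE l. dom (the (T e)) = {..<l})"

definition entry :: "('e, 'a) monograph \<Rightarrow> 'e \<Rightarrow> 'a ordinal \<Rightarrow> 'e" where
  "entry T e i = the (the (T e) i)"

definition monogr_hom :: "('e, 'a) monograph \<Rightarrow> ('f, 'a) monograph \<Rightarrow> ('e \<Rightarrow> 'f) set" where
  "monogr_hom T T' =
     {f \<in> edges T \<rightarrow>\<^sub>E edges T'.
        \<forall>e\<in>edges T. len T' (f e) = len T e \<and>
          (\<forall>i<len T e. f (entry T e i) = entry T' (f e) i)}"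

definition monogr_id :: "('e, 'a) monograph \<Rightarrow> 'e \<Rightarrow> 'e" where
  "monogr_id T = (\<lambda>e\<in>edges T. e)"

definition monogr_comp ::
  "('e, 'a) monograph \<Rightarrow> ('f \<Rightarrow> 'g) \<Rightarrow> ('e \<Rightarrow> 'f) \<Rightarrow> 'e \<Rightarrow> 'g" where
  "monogr_comp T g f = compose (edges T) g f"

text \<open>The set of sorts is part of a signature: a sort need not occur in any arity.\<close>

record ('o, 's) signature =
  sorts :: "'s set"
  arity :: "'o \<rightharpoonup> 's list"

definition ops :: "('o, 's) signature \<Rightarrow> 'o set" where
  "ops \<Sigma> = dom (arity \<Sigma>)"

definition is_signature :: "('o, 's) signature \<Rightarrow> bool" where
  "is_signature \<Sigma> \<longleftrightarrow>
     (\<forall>p\<in>ops \<Sigma>. the (arity \<Sigma> p) \<in> lists (sorts \<Sigma>) \<and> the (arity \<Sigma> p) \<noteq> [])"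

definition graph_structure :: "('o, 's) signature \<Rightarrow> bool" where
  "graph_structure \<Sigma> \<longleftrightarrow>
     is_signature \<Sigma> \<and> (\<forall>p\<in>ops \<Sigma>. length (the (arity \<Sigma> p)) = 2)"

definition sig_hom ::
  "('o, 's) signature \<Rightarrow> ('p, 't) signature \<Rightarrow> (('o \<Rightarrow> 'p) \<times> ('s \<Rightarrow> 't)) set" where
  "sig_hom \<Sigma> \<Sigma>' =
     {(ro, rs). ro \<in> ops \<Sigma> \<rightarrow>\<^sub>E ops \<Sigma>' \<and> rs \<in> sorts \<Sigma> \<rightarrow>\<^sub>E sorts \<Sigma>' \<and>
        (\<forall>p\<in>ops \<Sigma>. the (arity \<Sigma>' (ro p)) = map rs (the (arity \<Sigma> p)))}"

definition sig_id :: "('o, 's) signature \<Rightarrow> ('o \<Rightarrow> 'o) \<times> ('s \<Rightarrow> 's)" where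
  "sig_id \<Sigma> = (\<lambda>p\<in>ops \<Sigma>. p, \<lambda>s\<in>sorts \<Sigma>. s)"

definition sig_comp ::
  "('o, 's) signature \<Rightarrow> ('p \<Rightarrow> 'q) \<times> ('t \<Rightarrow> 'u) \<Rightarrow> ('o \<Rightarrow> 'p) \<times> ('s \<Rightarrow> 't) \<Rightarrow>
   ('o \<Rightarrow> 'q) \<times> ('s \<Rightarrow> 'u)" where
  "sig_comp \<Sigma> q r =
     (compose (ops \<Sigma>) (fst q) (fst r), compose (sorts \<Sigma>) (snd q) (snd r))"

text \<open>The two signatures may live over different types, so this is stated between any two of them.\<close>

definition sig_isomorphic :: "('o, 's) signature \<Rightarrow> ('p, 't) signature \<Rightarrow> bool" where
  "sig_isomorphic \<Sigma> \<Sigma>' \<longleftrightarrow>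
     (\<exists>r\<in>sig_hom \<Sigma> \<Sigma>'. \<exists>q\<in>sig_hom \<Sigma>' \<Sigma>.
        sig_comp \<Sigma> q r = sig_id \<Sigma> \<and> sig_comp \<Sigma>' r q = sig_id \<Sigma>')"

definition S_obj :: "('e, 'a) monograph \<Rightarrow> ('e \<times> 'a ordinal, 'e) signature" where
  "S_obj T =
     \<lparr>sorts = edges T,
      arity = (\<lambda>(e, i). if e \<in> edges T \<and> i < len T e then Some [e, entry T e i] else None)\<rparr>"

definition S_mor ::
  "('e, 'a) monograph \<Rightarrow> ('e \<Rightarrow> 'f) \<Rightarrow>
   ('e \<times> 'a ordinal \<Rightarrow> 'f \<times> 'a ordinal) \<times> ('e \<Rightarrow> 'f)" where
  "S_mor T f = (restrict (\<lambda>(e, i). (f e, i)) (ops (S_obj T)), f)"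

end

theory Submission
  imports Defs
begin

text \<open>
  Injectivity on objects holds because the edges of \<open>T\<close> are the sorts of \<open>S(T)\<close>, the length \<open>|e|\<close>
  is determined by which \<open>[e, \<iota>]\<close> are operators, and \<open>e\<^sub>\<iota>\<close> is the second sort of \<open>[e, \<iota>]\<close>.
  For density, take the sorts of \<open>\<Sigma>\<close> as edges and, for each
  sort \<open>s\<close>, well-order the operators with domain sort \<open>s\<close>: the edge \<open>s\<close> is the sequence of their
  range sorts, enumerated along this well-order.
\<close>

text \<open>Well-order \<open>A\<close> and send each element to the order type of its strict
  initial segment. All these segments are relations on \<open>'a\<close>, so their types lie in
  \<open>'a ordinal\<close>.\<close>

lemma ex_bij_betw_ordinal_lessThan:
  includes cardinal_syntax
  fixes A :: "'a set"
  shows "\<exists>h (l :: 'a ordinal). bij_betw h A {..<l}"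
proof -
  obtain r where r: "well_order_on A r"
    using well_order_on by blast
  have F: "Field r = A" and W: "Well_order r"
    using well_order_on_Well_order[OF r] by simp_all
  define seg where "seg a = Restr r (underS r a)" for a
  define h where "h a = abs_ordinal (seg a)" for a
  \<comment> \<open>The quotient is partial: equations about \<open>abs_ordinal\<close> apply only
    to relations that are \<open>=o\<close> to themselves, i.e. well-orders.\<close>
  have refl: "r =o r" "seg a =o seg a" for a
    using W by (auto simp: seg_def intro: ordIso_reflexive Well_order_Restr)
  \<comment> \<open>The order types below that of \<open>r\<close> are exactly those of its proper
    initial segments. This gives both inclusions for the image of \<open>h\<close>.\<close>
  have less_iff: "abs_ordinal s < abs_ordinal r \<longleftrightarrow> (\<exists>a\<in>A. abs_ordinal s = h a)"
    if "s =o s" for s :: "'a rel"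
  proof -
    have "abs_ordinal s < abs_ordinal r \<longleftrightarrow> s <o r"
      using that refl(1) by (rule less_ordinal.abs_eq)
    also have "\<dots> \<longleftrightarrow> (\<exists>a\<in>A. s =o seg a)"
      using ordLess_iff_ordIso_Restr[OF W, of s] that F
      by (auto simp: seg_def ordIso_def)
    also have "\<dots> \<longleftrightarrow> (\<exists>a\<in>A. abs_ordinal s = h a)"
      using Quotient3_rel[OF Quotient3_ordinal] that refl(2) by (auto simp: h_def)
    finally show ?thesis .
  qed
  \<comment> \<open>A strictly longer initial segment has a strictly larger order type; totality of
    \<open>r\<close> then makes \<open>h\<close> injective.\<close>
  have mono: "h a < h b" if "(a, b) \<in> r" "a \<noteq> b" for a b
  proof -
    have ab: "a \<in> underS r b" using that by (auto simp: underS_def)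
    have R: "wo_rel r" using W by (simp add: wo_rel_def)
    have "underS r a \<subset> underS r b"
      using ab R
      by (metis BNF_Wellorder_Relation.wo_rel.ANTISYM wo_rel.TRANS underS_incr psubsetI
          that(1) underS_notIn)
    then have "seg a <o seg b"
      unfolding seg_def
      using W R by (simp add: ofilter_subset_ordLess wo_rel.underS_ofilter)
    then show ?thesis
      using refl(2) by (simp add: h_def less_ordinal.abs_eq)
  qed
  have "inj_on h A"
  proof (rule inj_onI, rule ccontr)
    fix a b assume "a \<in> A" "b \<in> A" "h a = h b" "a \<noteq> b"
    moreover from this have "(a, b) \<in> r \<or> (b, a) \<in> r"
      using r by (auto simp: well_order_on_def linear_order_on_def total_on_def)
    ultimately show False using mono[of a b] mono[of b a] by auto
  qed
  moreover have "h ` A = {..<abs_ordinal r}"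
  proof
    show "h ` A \<subseteq> {..<abs_ordinal r}"
      using less_iff refl(2) by (auto simp: h_def)
    show "{..<abs_ordinal r} \<subseteq> h ` A"
    proof
      fix y assume y: "y \<in> {..<abs_ordinal r}"
      have "rep_ordinal y =o rep_ordinal y" "abs_ordinal (rep_ordinal y) = y"
        by (simp_all add: Quotient3_abs_rep[OF Quotient3_ordinal]
            Quotient3_rep_reflp[OF Quotient3_ordinal])
      then show "y \<in> h ` A" using y less_iff[of "rep_ordinal y"] by auto
    qed
  qed
  ultimately show ?thesis unfolding bij_betw_def by blast
qed

text \<open>The description in \<open>len\<close> is unique because an ordinal is determined by the
  set of ordinals below it.\<close>

lemma len_eqI: "dom (the (T e)) = {..<l} \<Longrightarrow> len T e = l"
  unfolding len_def by (rule the_equality) simp_all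

lemma dom_monograph:
  "is_monograph T \<Longrightarrow> e \<in> edges T \<Longrightarrow> dom (the (T e)) = {..<len T e}"
  using len_eqI unfolding is_monograph_def by metis

text \<open>Recovers a monograph from its edges, lengths and entries, so that injectivity on objects
  only has to compare these.\<close>

lemma monograph_apply:
  assumes "is_monograph T" "e \<in> edges T"
  shows "T e = Some (\<lambda>i. if i < len T e then Some (entry T e i) else None)"
proof -
  obtain m where m: "T e = Some m" using assms(2) by (auto simp: edges_def)
  have "dom m = {..<len T e}" using dom_monograph[OF assms] m by simp
  then have "m i = (if i < len T e then Some (entry T e i) else None)" for i
    unfolding entry_def m by (cases "m i") (metis domIff lessThan_iff option.sel)+
  then show ?thesis using m by auto
qed

lemma entry_in_edges:
  assumes "is_monograph T" "e \<in> edges T" "i < len T e"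
  shows "entry T e i \<in> edges T"
proof -
  have "ran (the (T e)) \<subseteq> edges T" using assms by (simp add: is_monograph_def)
  moreover have "the (T e) i = Some (entry T e i)"
    using monograph_apply[OF assms(1,2)] assms(3) by simp
  ultimately show ?thesis by (auto intro: ranI)
qed

lemma sorts_S_obj [simp]: "sorts (S_obj T) = edges T"
  by (simp add: S_obj_def)

lemma in_ops_S_obj [simp]: "(e, i) \<in> ops (S_obj T) \<longleftrightarrow> e \<in> edges T \<and> i < len T e"
  by (simp add: S_obj_def ops_def dom_def)

lemma arity_S_obj:
  "e \<in> edges T \<Longrightarrow> i < len T e \<Longrightarrow> arity (S_obj T) (e, i) = Some [e, entry T e i]"
  by (simp add: S_obj_def)

lemma graph_structure_S_obj: "is_monograph T \<Longrightarrow> graph_structure (S_obj T)"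
  by (auto simp: graph_structure_def is_signature_def arity_S_obj entry_in_edges)

lemma S_mor_id: "S_mor T (monogr_id T) = sig_id (S_obj T)"
  by (auto simp: S_mor_def monogr_id_def sig_id_def restrict_def fun_eq_iff)

text \<open>Preservation of lengths keeps \<open>(f e, i)\<close> an operator; preservation of
  entries is the arity condition.\<close>

lemma S_mor_hom:
  assumes "is_monograph T" "f \<in> monogr_hom T T'"
  shows "S_mor T f \<in> sig_hom (S_obj T) (S_obj T')"
  using assms
  by (auto simp: S_mor_def sig_hom_def monogr_hom_def arity_S_obj PiE_iff entry_in_edges)

text \<open>Since \<open>f\<close> preserves edges and lengths, \<open>(f e, i)\<close> is an
  operator of \<open>S_obj T'\<close>, where the restriction inside \<open>S_mor T' g\<close> has no
  effect.\<close>

lemma S_mor_comp: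
  assumes "f \<in> monogr_hom T T'"
  shows "S_mor T (monogr_comp T g f) = sig_comp (S_obj T) (S_mor T' g) (S_mor T f)"
  using assms
  by (auto simp: S_mor_def monogr_comp_def sig_comp_def compose_def restrict_def fun_eq_iff
      monogr_hom_def PiE_iff)

text \<open>Gives faithfulness: the second component of \<open>S_mor T f\<close> is \<open>f\<close>
  itself.\<close>

lemma inj_S_mor: "inj (S_mor T)"
  by (rule injI) (simp add: S_mor_def)

lemma inj_on_S_obj: "inj_on S_obj {T :: ('e, 'a) monograph. is_monograph T}"
proof (rule inj_onI, rule ext)
  fix T T' :: "('e, 'a) monograph" and e
  assume "T \<in> {T. is_monograph T}" "T' \<in> {T. is_monograph T}" and eq: "S_obj T = S_obj T'"
  then have T: "is_monograph T" "is_monograph T'" by auto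
  have E: "edges T = edges T'" using eq by (metis sorts_S_obj)
  show "T e = T' e"
  proof (cases "e \<in> edges T")
    case True
    then have "i < len T e \<longleftrightarrow> i < len T' e" for i
      using in_ops_S_obj[of e i T] in_ops_S_obj[of e i T'] eq E by simp
    \<comment> \<open>If the lengths differed, the smaller one would be a position of
      \<open>e\<close> in one monograph only.\<close>
    then have l: "len T e = len T' e" by (metis less_irrefl linorder_neqE)
    have "entry T e i = entry T' e i" if "i < len T e" for i
      using arity_S_obj[of e T i] arity_S_obj[of e T' i] that True eq E l by simp
    then show ?thesis
      using monograph_apply[OF T(1)] monograph_apply[OF T(2)] True E l by auto
  next
    case False
    then show ?thesis using E unfolding edges_def by (metis domIff)
  qed
qed

text \<open>The componentwise inverse of a bijective morphism is again a morphism, so isomorphisms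
  need not be built with an explicit inverse.\<close>

lemma sig_isomorphicI:
  assumes hom: "(ro, rs) \<in> sig_hom \<Sigma> \<Sigma>'" and sig: "is_signature \<Sigma>"
    and ro: "bij_betw ro (ops \<Sigma>) (ops \<Sigma>')" and rs: "bij_betw rs (sorts \<Sigma>) (sorts \<Sigma>')"
  shows "sig_isomorphic \<Sigma> \<Sigma>'"
proof -
  \<comment> \<open>The inverses are restricted because \<open>sig_hom\<close> demands extensional
    functions.\<close>
  define qo where "qo = restrict (inv_into (ops \<Sigma>) ro) (ops \<Sigma>')"
  define qs where "qs = restrict (inv_into (sorts \<Sigma>) rs) (sorts \<Sigma>')"
  have qo: "qo (ro p) = p" "ro p \<in> ops \<Sigma>'" if "p \<in> ops \<Sigma>" for p
    using ro that by (auto simp: qo_def bij_betw_apply bij_betw_inv_into_left)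
  have qs: "qs (rs s) = s" "rs s \<in> sorts \<Sigma>'" if "s \<in> sorts \<Sigma>" for s
    using rs that by (auto simp: qs_def bij_betw_apply bij_betw_inv_into_left)
  have ro': "ro (qo p) = p" "qo p \<in> ops \<Sigma>" if "p \<in> ops \<Sigma>'" for p
    using ro that
    by (auto simp: qo_def bij_betw_inv_into_right bij_betw_apply[OF bij_betw_inv_into])
  have rs': "rs (qs s) = s" "qs s \<in> sorts \<Sigma>" if "s \<in> sorts \<Sigma>'" for s
    using rs that
    by (auto simp: qs_def bij_betw_inv_into_right bij_betw_apply[OF bij_betw_inv_into])
  have "the (arity \<Sigma> (qo p)) = map qs (the (arity \<Sigma>' p))" if p: "p \<in> ops \<Sigma>'" for p
  proof -
    let ?a = "the (arity \<Sigma> (qo p))"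
    have "the (arity \<Sigma>' p) = map rs ?a"
      using hom ro'[OF p] by (auto simp: sig_hom_def)
    \<comment> \<open>Arities consist of sorts, and on sorts \<open>qs\<close> undoes
      \<open>rs\<close>.\<close>
    moreover have "set ?a \<subseteq> sorts \<Sigma>"
      using sig ro'(2)[OF p] by (auto simp: is_signature_def)
    then have "map qs (map rs ?a) = ?a"
      using qs(1) by (auto intro!: map_idI)
    ultimately show ?thesis by simp
  qed
  moreover have "qo \<in> ops \<Sigma>' \<rightarrow>\<^sub>E ops \<Sigma>" "qs \<in> sorts \<Sigma>' \<rightarrow>\<^sub>E sorts \<Sigma>"
    using ro'(2) rs'(2) by (auto simp: qo_def qs_def)
  ultimately have "(qo, qs) \<in> sig_hom \<Sigma>' \<Sigma>"
    by (simp add: sig_hom_def)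
  moreover have "sig_comp \<Sigma> (qo, qs) (ro, rs) = sig_id \<Sigma>"
    "sig_comp \<Sigma>' (ro, rs) (qo, qs) = sig_id \<Sigma>'"
    using qo(1) qs(1) ro'(1) rs'(1)
    by (auto simp: sig_comp_def sig_id_def compose_def intro!: restrict_ext)
  ultimately show ?thesis
    using hom unfolding sig_isomorphic_def by blast
qed

text \<open>Parallel operators, with equal source and target, stay distinct because they get
  different positions in the edge of their source. Ordinals over \<open>'o\<close> suffice, as each
  \<open>A s\<close> is a set of operators.\<close>

lemma ex_monograph_sig_isomorphic:
  fixes \<Sigma> :: "('o, 's) signature"
  assumes "graph_structure \<Sigma>"
  shows "\<exists>T :: ('s, 'o) monograph. is_monograph T \<and> sig_isomorphic \<Sigma> (S_obj T)"
proof -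
  define src where "src p = the (arity \<Sigma> p) ! 0" for p
  define tgt where "tgt p = the (arity \<Sigma> p) ! 1" for p
  define A where "A s = {p \<in> ops \<Sigma>. src p = s}" for s
  have sig: "is_signature \<Sigma>" using assms by (simp add: graph_structure_def)
  have ar: "the (arity \<Sigma> p) = [src p, tgt p]" and srt: "src p \<in> sorts \<Sigma>" "tgt p \<in> sorts \<Sigma>"
    if "p \<in> ops \<Sigma>" for p
  proof -
    have "length (the (arity \<Sigma> p)) = 2" using assms that by (simp add: graph_structure_def)
    then show ar: "the (arity \<Sigma> p) = [src p, tgt p]"
      by (auto simp: src_def tgt_def length_Suc_conv numeral_2_eq_2)
    show "src p \<in> sorts \<Sigma>" "tgt p \<in> sorts \<Sigma>"
      using sig that ar by (auto simp: is_signature_def)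
  qed
  have "\<forall>s. \<exists>h (l :: 'o ordinal). bij_betw h (A s) {..<l}"
    using ex_bij_betw_ordinal_lessThan by blast
  then obtain h and l :: "'s \<Rightarrow> 'o ordinal" where h: "\<And>s. bij_betw (h s) (A s) {..<l s}"
    by metis
  \<comment> \<open>Entry \<open>i\<close> of \<open>s\<close> is the range sort of the operator
    enumerated at position \<open>i\<close>; a sort that is the source of no operator becomes an
    edge of length zero.\<close>
  define T :: "('s, 'o) monograph" where
    "T = (\<lambda>s. if s \<in> sorts \<Sigma>
       then Some (\<lambda>i. if i < l s then Some (tgt (inv_into (A s) (h s) i)) else None) else None)"
  have E: "edges T = sorts \<Sigma>"
    by (auto simp: edges_def T_def dom_def)
  have dom_T: "dom (the (T s)) = {..<l s}" if "s \<in> sorts \<Sigma>" for s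
    using that by (auto simp: T_def dom_def)
  have len: "len T s = l s" if "s \<in> sorts \<Sigma>" for s
    using dom_T[OF that] by (rule len_eqI)
  have "inv_into (A s) (h s) i \<in> ops \<Sigma>" if "i < l s" for s i
    using bij_betw_apply[OF bij_betw_inv_into[OF h[of s]], of i] that by (auto simp: A_def)
  then have "ran (the (T s)) \<subseteq> sorts \<Sigma>" if "s \<in> sorts \<Sigma>" for s
    using that srt(2) by (auto simp: T_def ran_def split: if_splits)
  then have mono: "is_monograph T"
    using dom_T E unfolding is_monograph_def by blast
  have hl: "h (src p) p < l (src p)" and entry: "entry T (src p) (h (src p) p) = tgt p"
    if "p \<in> ops \<Sigma>" for p
  proof -
    have p: "p \<in> A (src p)" using that by (simp add: A_def)
    show *: "h (src p) p < l (src p)" using bij_betw_apply[OF h p] by simp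
    show "entry T (src p) (h (src p) p) = tgt p"
      using * srt(1)[OF that] bij_betw_inv_into_left[OF h p] by (simp add: entry_def T_def)
  qed
  \<comment> \<open>An operator corresponds to its source together with its position there; sorts
    are already edges, so \<open>rs\<close> is the identity.\<close>
  define ro where "ro = (\<lambda>p\<in>ops \<Sigma>. (src p, h (src p) p))"
  define rs where "rs = (\<lambda>s\<in>sorts \<Sigma>. s)"
  have "(ro, rs) \<in> sig_hom \<Sigma> (S_obj T)"
    using hl srt by (auto simp: sig_hom_def ro_def rs_def E len ar arity_S_obj entry)
  moreover have "bij_betw ro (ops \<Sigma>) (ops (S_obj T))"
  proof (rule bij_betw_imageI)
    show "inj_on ro (ops \<Sigma>)"
    proof (rule inj_onI)
      fix p q assume pq: "p \<in> ops \<Sigma>" "q \<in> ops \<Sigma>" "ro p = ro q"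
      then have "src p = src q" "h (src p) p = h (src p) q" by (auto simp: ro_def)
      \<comment> \<open>Equal sources put \<open>p\<close> and \<open>q\<close> into the same
        \<open>A s\<close>, on which \<open>h s\<close> is injective.\<close>
      with pq show "p = q"
        using bij_betw_imp_inj_on[OF h[of "src p"]] by (auto simp: A_def inj_on_def)
    qed
    show "ro ` ops \<Sigma> = ops (S_obj T)"
    proof (intro equalityI subsetI)
      fix x assume "x \<in> ro ` ops \<Sigma>"
      then show "x \<in> ops (S_obj T)" using hl srt(1) by (auto simp: ro_def E len)
    next
      fix x assume x: "x \<in> ops (S_obj T)"
      obtain s i where si: "x = (s, i)" by (cases x)
      \<comment> \<open>Every position below \<open>l s\<close> is taken by an operator with source
        \<open>s\<close>.\<close>
      then have "i \<in> h s ` A s" using x bij_betw_imp_surj_on[OF h[of s]] by (auto simp: E len)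
      then show "x \<in> ro ` ops \<Sigma>" using si by (auto simp: A_def ro_def image_iff)
    qed
  qed
  moreover have "bij_betw rs (sorts \<Sigma>) (sorts (S_obj T))"
    by (auto simp: rs_def E bij_betw_def inj_on_def)
  ultimately show ?thesis
    using mono sig sig_isomorphicI by blast
qed

theorem theorem4:
  shows
    "(\<forall>T :: ('s, 'o) monograph. is_monograph T \<longrightarrow>
        graph_structure (S_obj T) \<and> S_mor T (monogr_id T) = sig_id (S_obj T)) \<and>
     (\<forall>(T :: ('s, 'o) monograph) (T' :: ('s, 'o) monograph). is_monograph T \<longrightarrow> is_monograph T' \<longrightarrow>
        (\<forall>f\<in>monogr_hom T T'. S_mor T f \<in> sig_hom (S_obj T) (S_obj T'))) \<and>
     (\<forall>(T :: ('s, 'o) monograph) (T' :: ('s, 'o) monograph) (T'' :: ('s, 'o) monograph).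
        is_monograph T \<longrightarrow> is_monograph T' \<longrightarrow> is_monograph T'' \<longrightarrow>
        (\<forall>f\<in>monogr_hom T T'. \<forall>g\<in>monogr_hom T' T''.
           S_mor T (monogr_comp T g f) = sig_comp (S_obj T) (S_mor T' g) (S_mor T f))) \<and>
     (\<forall>(T :: ('s, 'o) monograph) (T' :: ('s, 'o) monograph). is_monograph T \<longrightarrow> is_monograph T' \<longrightarrow>
        inj_on (S_mor T) (monogr_hom T T')) \<and>
     inj_on S_obj {T :: ('s, 'o) monograph. is_monograph T} \<and>
     (\<forall>\<Sigma> :: ('o, 's) signature. graph_structure \<Sigma> \<longrightarrow>
        (\<exists>T :: ('s, 'o) monograph. is_monograph T \<and> sig_isomorphic \<Sigma> (S_obj T)))"
  by (intro conjI allI impI ballI)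
    (simp_all add: graph_structure_S_obj S_mor_id S_mor_hom S_mor_comp inj_on_S_obj
      inj_on_subset[OF inj_S_mor] ex_monograph_sig_isomorphic)

end
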